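(* Let $K$ be a compact Hausdorff space and let $X$ be a nontrivial complex uniformly convex Banach space. Suppose that $A(K,X)$ is an $X$-valued function space over a base algebra $A$ satisfying the additional condition $A\otimes X\subset A(K,X)$. Let $\Gamma'$ be the set of limit points in the Shilov boundary $\Gamma$ of $A$, and let $\rho(A)$ be the set of all strong peak points for $A$. If $\rho(A)\cap\Gamma'\ne\emptyset$, then $A(K,X)$ has the convex diametral local diameter two property (convex-DLD2P).
   Context: A uniform algebra on a compact Hausdorff space $K$ is a closed subalgebra of $C(K)$ (complex-valued, supremum norm) that separates the points of $K$ and contains the constant functions. $C(K,X)$ is the Banach space of norm-continuous functions $K\to X$ with $\|f\|=\sup_{t\in K}\|f(t)\|_X$. A closed subspace $A(K,X)$ of $C(K,X)$ is an $X$-valued function space over a uniform algebra if (i) the base algebra $A:=\{x^*\circ f: f\in A(K,X),\ x^*\in X^*\}$ is a uniform algebra on $K$; and (ii) $\phi f\in A(K,X)$ for all $\phi\in A$, $f\in A(K,X)$, where $(\phi f)(t)=\phi(t)f(t)$. $A\otimes X$ is the set of functions $\phi\otimes x$ ($\phi\in A$, $x\in X$), $(\phi\otimes x)(t)=\phi(t)x$. A boundary for $A$ is a set $S\subset K$ such that for every $\phi\in A$ there is $t\in S$ with $|\phi(t)|=\|\phi\|_\infty$; the Shilov boundary of $A$ is the smallest closed boundary of $A$. A point $t_0\in K$ is a strong peak point for $A$ if there is $\phi\in A$ such that $|\phi(t_0)|=\|\phi\|_\infty$ and $\|\phi\|_\infty>\sup\{|\phi(t)|:t\in K\setminus U\}$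 for every open neighborhood $U$ of $t_0$. For a Banach space $Z$ with closed unit ball $B_Z$ and unit sphere $S_Z$, $z\in S_Z$ and $\epsilon>0$, let $\Delta_\epsilon(z)=\{y\in B_Z:\|z-y\|\ge 2-\epsilon\}$. A point $z\in S_Z$ is a $\Delta$-point if $z\in\overline{\mathrm{conv}}\,\Delta_\epsilon(z)$ for every $\epsilon>0$. $Z$ has the convex-DLD2P if $B_Z$ is the closed convex hull of the set of all $\Delta$-points of $Z$. $X$ is uniformly convex if $\delta_X(\epsilon)=\inf\{1-\|\frac{x+y}{2}\|: x,y\in B_X,\ \|x-y\|\ge\epsilon\}>0$ for each $0<\epsilon<2$. *)

theory Defs
  imports "HOL-Analysis.Analysis"
begin

section \<open>Complex normed spaces\<close>

class complex_normed_vector = real_normed_vector +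
  fixes scaleC :: "complex \<Rightarrow> 'a \<Rightarrow> 'a"  (infixr \<open>*\<^sub>C\<close> 75)
  assumes scaleC_add_right: "c *\<^sub>C (x + y) = c *\<^sub>C x + c *\<^sub>C y"
    and scaleC_add_left: "(c + d) *\<^sub>C x = c *\<^sub>C x + d *\<^sub>C x"
    and scaleC_scaleC: "c *\<^sub>C d *\<^sub>C x = (c * d) *\<^sub>C x"
    and scaleC_of_real: "complex_of_real r *\<^sub>C x = r *\<^sub>R x"
    and norm_scaleC: "norm (c *\<^sub>C x) = cmod c * norm x"

global_interpretation complex_vector: vector_space "scaleC :: complex \<Rightarrow> 'a \<Rightarrow> 'a :: complex_normed_vector"
proof
  show "1 *\<^sub>C x = x" for x :: 'a
    using scaleC_of_real[of 1 x] by simp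
qed (simp_all add: scaleC_add_right scaleC_add_left scaleC_scaleC)

instantiation complex :: complex_normed_vector
begin

definition scaleC_complex :: "complex \<Rightarrow> complex \<Rightarrow> complex"
  where "scaleC_complex c x = c * x"

instance
  by standard (simp_all add: scaleC_complex_def algebra_simps norm_mult scaleR_conv_of_real)

end

lemma bounded_bilinear_scaleC:
  "bounded_bilinear (scaleC :: complex \<Rightarrow> 'a \<Rightarrow> 'a :: complex_normed_vector)"
proof
  fix c d :: complex and x y :: 'a and r :: real
  show "(c + d) *\<^sub>C x = c *\<^sub>C x + d *\<^sub>C x" "c *\<^sub>C (x + y) = c *\<^sub>C x + c *\<^sub>C y"
    by (fact scaleC_add_left scaleC_add_right)+
  show "(r *\<^sub>R c) *\<^sub>C x = r *\<^sub>R c *\<^sub>C x" "c *\<^sub>C r *\<^sub>R x = r *\<^sub>R c *\<^sub>C x"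
    by (simp_all only: scaleC_of_real[of r x, symmetric] scaleC_of_real[of r "c *\<^sub>C x", symmetric]
        scaleC_scaleC scaleR_conv_of_real[of r c] mult.commute)
  show "\<exists>K. \<forall>c (x :: 'a). norm (c *\<^sub>C x) \<le> norm c * norm x * K"
    by (rule exI[of _ 1]) (simp add: norm_scaleC)
qed

lemma bcontfun_scaleC_mem:
  assumes "\<phi> \<in> bcontfun" "f \<in> bcontfun"
  shows "(\<lambda>t. \<phi> t *\<^sub>C (f t :: 'b :: complex_normed_vector)) \<in> bcontfun"
proof -
  from assms obtain a b where "\<And>t. cmod (\<phi> t) \<le> a" "\<And>t. norm (f t) \<le> b"
    by (auto simp: bcontfun_def bounded_iff)
  then have "norm (\<phi> t *\<^sub>C f t) \<le> a * b" for t
    by (simp add: norm_scaleC) (meson mult_mono norm_ge_zero order_trans)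
  moreover have "continuous_on UNIV (\<lambda>t. \<phi> t *\<^sub>C f t)"
    using assms by (auto simp: bcontfun_def intro: bounded_bilinear.continuous_on[OF bounded_bilinear_scaleC])
  ultimately show ?thesis
    by (rule bcontfun_normI[rotated])
qed


section \<open>Spaces of continuous functions on a compact space\<close>

text \<open>
  The compact Hausdorff space K is a type of class \<^class>\<open>t2_space\<close> whose universe is assumed
  compact. Every continuous function on it is then bounded, so that the type of bounded continuous
  functions, with the supremum norm, is C(K,X).
\<close>

text \<open>The pointwise product of a scalar and a vector-valued function; for complex-valued functions
  this is multiplication in C(K).\<close>

context includes bcontfun.lifting
begin

lift_definition bcontfun_mult ::
    "('k::topological_space \<Rightarrow>\<^sub>C complex) \<Rightarrow> ('k \<Rightarrow>\<^sub>C 'x::complex_normed_vector) \<Rightarrow> ('k \<Rightarrow>\<^sub>C 'x)"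
    (infixl \<open>\<odot>\<close> 70)
  is "\<lambda>\<phi> f t. \<phi> t *\<^sub>C f t"
  by (rule bcontfun_scaleC_mem)

end

lemma apply_bcontfun_mult [simp]: "apply_bcontfun (\<phi> \<odot> f) t = \<phi> t *\<^sub>C f t"
  by (simp add: bcontfun_mult.rep_eq)

instantiation bcontfun :: (topological_space, complex_normed_vector) complex_normed_vector
begin

definition scaleC_bcontfun :: "complex \<Rightarrow> ('a \<Rightarrow>\<^sub>C 'b) \<Rightarrow> ('a \<Rightarrow>\<^sub>C 'b)"
  where "scaleC_bcontfun c f = const_bcontfun c \<odot> f"

instance
proof
  fix c d :: complex and f g :: "'a \<Rightarrow>\<^sub>C 'b" and r :: real
  show "c *\<^sub>C (f + g) = c *\<^sub>C f + c *\<^sub>C g"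
    by (intro bcontfun_eqI) (simp add: scaleC_bcontfun_def scaleC_add_right)
  show "(c + d) *\<^sub>C f = c *\<^sub>C f + d *\<^sub>C f"
    by (intro bcontfun_eqI) (simp add: scaleC_bcontfun_def scaleC_add_left)
  show scale: "c *\<^sub>C d *\<^sub>C f = (c * d) *\<^sub>C f" for c d and f :: "'a \<Rightarrow>\<^sub>C 'b"
    by (intro bcontfun_eqI) (simp add: scaleC_bcontfun_def scaleC_scaleC)
  show real: "complex_of_real r *\<^sub>C f = r *\<^sub>R f" for r and f :: "'a \<Rightarrow>\<^sub>C 'b"
    by (intro bcontfun_eqI) (simp add: scaleC_bcontfun_def scaleC_of_real)
  have le: "norm (c *\<^sub>C f) \<le> cmod c * norm f" for c and f :: "'a \<Rightarrow>\<^sub>C 'b"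
    by (intro norm_bound) (simp add: scaleC_bcontfun_def norm_scaleC mult_left_mono norm_bounded)
  show "norm (c *\<^sub>C f) = cmod c * norm f"
  proof (cases "c = 0")
    case True
    then show ?thesis using le[of c f] by simp
  next
    case False
    have "f = inverse c *\<^sub>C c *\<^sub>C f"
      using False real[of 1 f] by (simp add: scale)
    then have "norm f \<le> norm (c *\<^sub>C f) / cmod c"
      using le[of "inverse c" "c *\<^sub>C f"] by (simp add: norm_inverse divide_inverse mult.commute)
    then have "cmod c * norm f \<le> norm (c *\<^sub>C f)"
      using False by (simp add: pos_le_divide_eq mult.commute)
    with le[of c f] show ?thesis by simp
  qed
qed

end


section \<open>Uniform algebras and vector-valued function spaces over them\<close>

definition uniform_algebra :: "('k::topological_space \<Rightarrow>\<^sub>C complex) set \<Rightarrow> bool" where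
  "uniform_algebra A \<longleftrightarrow>
     complex_vector.subspace A \<and> (\<forall>\<phi>\<in>A. \<forall>\<psi>\<in>A. \<phi> \<odot> \<psi> \<in> A) \<and> closed A \<and>
     (\<forall>s t. s \<noteq> t \<longrightarrow> (\<exists>\<phi>\<in>A. apply_bcontfun \<phi> s \<noteq> apply_bcontfun \<phi> t)) \<and> range const_bcontfun \<subseteq> A"

definition complex_dual :: "('x::complex_normed_vector \<Rightarrow> complex) set" where
  "complex_dual = {h. bounded_linear h \<and> (\<forall>c x. h (c *\<^sub>C x) = c * h x)}"

definition base_algebra ::
    "('k::topological_space \<Rightarrow>\<^sub>C 'x::complex_normed_vector) set \<Rightarrow> ('k \<Rightarrow>\<^sub>C complex) set" where
  "base_algebra F = {\<phi>. \<exists>f\<in>F. \<exists>h\<in>complex_dual. apply_bcontfun \<phi> = h \<circ> apply_bcontfun f}"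

definition function_space_over_uniform_algebra ::
    "('k::topological_space \<Rightarrow>\<^sub>C 'x::complex_normed_vector) set \<Rightarrow> bool" where
  "function_space_over_uniform_algebra F \<longleftrightarrow>
     complex_vector.subspace F \<and> closed F \<and> uniform_algebra (base_algebra F) \<and>
     (\<forall>\<phi>\<in>base_algebra F. \<forall>f\<in>F. \<phi> \<odot> f \<in> F)"

definition elementary_tensors ::
    "('k::topological_space \<Rightarrow>\<^sub>C complex) set \<Rightarrow> ('k \<Rightarrow>\<^sub>C 'x::complex_normed_vector) set" where
  "elementary_tensors A = {\<phi> \<odot> const_bcontfun x |\<phi> x. \<phi> \<in> A}"


section \<open>Boundaries and peak points\<close>

definition is_boundary :: "('k::topological_space \<Rightarrow>\<^sub>C complex) set \<Rightarrow> 'k set \<Rightarrow> bool" where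
  "is_boundary A S \<longleftrightarrow> (\<forall>\<phi>\<in>A. \<exists>t\<in>S. cmod (apply_bcontfun \<phi> t) = norm \<phi>)"

text \<open>The least element is taken with respect to inclusion; for a uniform algebra on a compact
  space it exists by Shilov's theorem.\<close>

definition shilov_boundary :: "('k::topological_space \<Rightarrow>\<^sub>C complex) set \<Rightarrow> 'k set" where
  "shilov_boundary A = (LEAST S. closed S \<and> is_boundary A S)"

text \<open>For U the whole space the supremum is over the empty set; the condition is then void
  (supremum \<open>-\<infinity>\<close>), whereas \<^const>\<open>Sup\<close> on the reals would leave it unspecified.\<close>

definition strong_peak_points :: "('k::topological_space \<Rightarrow>\<^sub>C complex) set \<Rightarrow> 'k set" where
  "strong_peak_points A =
     {t0. \<exists>\<phi>\<in>A. cmod (apply_bcontfun \<phi> t0) = norm \<phi> \<and>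
            (\<forall>U. open U \<and> t0 \<in> U \<and> U \<noteq> UNIV \<longrightarrow> (SUP t\<in>UNIV - U. cmod (apply_bcontfun \<phi> t)) < norm \<phi>)}"


section \<open>Uniform convexity and the convex diametral local diameter two property\<close>

definition convexity_modulus :: "'x::real_normed_vector itself \<Rightarrow> real \<Rightarrow> real" where
  "convexity_modulus _ \<epsilon> =
     Inf {1 - norm ((x + y) /\<^sub>R 2) |x y :: 'x. norm x \<le> 1 \<and> norm y \<le> 1 \<and> norm (x - y) \<ge> \<epsilon>}"

definition uniformly_convex :: "'x::real_normed_vector itself \<Rightarrow> bool" where
  "uniformly_convex X \<longleftrightarrow> (\<forall>\<epsilon>. 0 < \<epsilon> \<and> \<epsilon> < 2 \<longrightarrow> convexity_modulus X \<epsilon> > 0)"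

text \<open>In the following, Z is a closed subspace of an ambient normed space, so that closures
  in Z and in the ambient space agree.\<close>

definition diametral_set :: "'z::real_normed_vector set \<Rightarrow> real \<Rightarrow> 'z \<Rightarrow> 'z set" where
  "diametral_set Z \<epsilon> z = {y \<in> Z. norm y \<le> 1 \<and> norm (z - y) \<ge> 2 - \<epsilon>}"

definition Delta_points :: "'z::real_normed_vector set \<Rightarrow> 'z set" where
  "Delta_points Z =
     {z \<in> Z. norm z = 1 \<and> (\<forall>\<epsilon>>0. z \<in> closure (convex hull (diametral_set Z \<epsilon> z)))}"

definition convex_DLD2P :: "'z::real_normed_vector set \<Rightarrow> bool" where
  "convex_DLD2P Z \<longleftrightarrow> {z \<in> Z. norm z \<le> 1} = closure (convex hull (Delta_points Z))"

end

theory Submission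
  imports Defs "HOL-Complex_Analysis.Cauchy_Integral_Formula"
begin

text \<open>
  Every neighbourhood of a Shilov boundary point contains the peak set of some element of the base
  algebra, so infinitely many functions of the algebra with values in the unit disc, each close to 1
  off its own small set and equal to -1 somewhere in it, are available near a limit point \<open>t0\<close> of the
  boundary. Multiplying \<open>f\<close> by them shows that every \<open>f\<close> of norm 1 with \<open>norm (f t0) = 1\<close> is a
  \<open>\<Delta>\<close>-point. If \<open>t0\<close> is also a strong peak point, then peak functions at \<open>t0\<close>, composed with
  \<open>1 - (1 - z)\<^sup>\<alpha>\<close> so as to take values in a Stolz region at 1, approximate any \<open>f\<close> in the unit ball by
  convex combinations of two functions that attain norm 1 at \<open>t0\<close>.
\<close>

section \<open>Uniform algebras\<close>

lemma uniform_algebraD: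
  assumes "uniform_algebra A"
  shows "\<And>\<phi> \<psi>. \<phi> \<in> A \<Longrightarrow> \<psi> \<in> A \<Longrightarrow> \<phi> + \<psi> \<in> A"
    and "\<And>\<phi> \<psi>. \<phi> \<in> A \<Longrightarrow> \<psi> \<in> A \<Longrightarrow> \<phi> - \<psi> \<in> A"
    and "\<And>\<phi> \<psi>. \<phi> \<in> A \<Longrightarrow> \<psi> \<in> A \<Longrightarrow> \<phi> \<odot> \<psi> \<in> A"
    and "\<And>c. const_bcontfun c \<in> A"
    and "closed A"
    and "\<And>s t. s \<noteq> t \<Longrightarrow> \<exists>\<phi>\<in>A. apply_bcontfun \<phi> s \<noteq> apply_bcontfun \<phi> t"
  using assms unfolding uniform_algebra_def
  by (auto intro: complex_vector.subspace_add complex_vector.subspace_diff)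

lemma bcontfun_attains_norm:
  fixes f :: "'k::topological_space \<Rightarrow>\<^sub>C 'b::real_normed_vector"
  assumes "compact (UNIV :: 'k set)"
  shows "\<exists>t. norm (f t) = norm f"
proof -
  obtain t where "\<And>s. norm (f s) \<le> norm (f t)"
    using continuous_attains_sup[OF assms, of "\<lambda>t. norm (f t)"]
    by (auto intro: continuous_on_norm)
  then have "norm f \<le> norm (f t)"
    by (rule norm_bound)
  with norm_bounded[of f t] show ?thesis
    by (intro exI[of _ t]) simp
qed

lemma compact_norm_eq:
  fixes f :: "'k::topological_space \<Rightarrow>\<^sub>C 'b::real_normed_vector"
  assumes "compact (UNIV :: 'k set)" "closed S"
  shows "compact {t\<in>S. norm (f t) = c}"
proof -
  have "closed {t. norm (f t) = c}"
    by (intro closed_Collect_eq continuous_on_norm) auto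
  with assms have "compact (UNIV \<inter> (S \<inter> {t. norm (f t) = c}))"
    by (intro compact_Int_closed closed_Int)
  then show ?thesis by (simp add: Int_def)
qed

lemma uniform_algebra_polynomial:
  assumes A: "uniform_algebra A" and "\<phi> \<in> A"
  shows "\<exists>\<psi>\<in>A. \<forall>t. apply_bcontfun \<psi> t = (\<Sum>i<n. c i * \<phi> t ^ i)"
proof -
  have pow: "\<exists>\<psi>\<in>A. \<forall>t. apply_bcontfun \<psi> t = \<phi> t ^ n" for n
  proof (induction n)
    case 0
    show ?case
      using uniform_algebraD(4)[OF A, of 1] by force
  next
    case (Suc n)
    then obtain \<psi> where "\<psi> \<in> A" "\<forall>t. apply_bcontfun \<psi> t = \<phi> t ^ n" by blast
    then show ?case
      using uniform_algebraD(3)[OF A \<open>\<phi> \<in> A\<close>]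
      by (intro bexI[of _ "\<phi> \<odot> \<psi>"]) (simp_all add: scaleC_complex_def)
  qed
  show ?thesis
  proof (induction n)
    case 0
    show ?case
      using uniform_algebraD(4)[OF A, of 0] by force
  next
    case (Suc n)
    then obtain \<psi> where "\<psi> \<in> A" "\<forall>t. apply_bcontfun \<psi> t = (\<Sum>i<n. c i * \<phi> t ^ i)" by blast
    moreover obtain \<theta> where "\<theta> \<in> A" "\<forall>t. apply_bcontfun \<theta> t = \<phi> t ^ n"
      using pow by blast
    ultimately show ?case
      by (intro bexI[of _ "\<psi> + const_bcontfun (c n) \<odot> \<theta>"] uniform_algebraD[OF A])
        (simp_all add: scaleC_complex_def)
  qed
qed

lemma uniform_algebra_power:
  assumes "uniform_algebra A" "\<phi> \<in> A"
  shows "\<exists>\<psi>\<in>A. \<forall>t. apply_bcontfun \<psi> t = (c * \<phi> t) ^ n"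
  using uniform_algebra_polynomial[OF assms, where n = "Suc n" and c = "\<lambda>i. if i = n then c ^ n else 0"]
  by (simp add: power_mult_distrib)

text \<open>On the compact set \<open>C\<close> the modulus of \<open>\<phi>\<close> has a maximum
  \<open>m\<close> strictly below \<open>norm \<phi>\<close>, so a high power of
  \<open>\<phi> / \<phi> s\<close> is as small as desired on \<open>C\<close>.\<close>

lemma peaking_function:
  fixes A :: "('k::topological_space \<Rightarrow>\<^sub>C complex) set"
  assumes K: "compact (UNIV :: 'k set)" and A: "uniform_algebra A" "\<phi> \<in> A"
    and s: "cmod (\<phi> s) = norm \<phi>" and C: "closed C" "\<And>t. t \<in> C \<Longrightarrow> cmod (\<phi> t) \<noteq> norm \<phi>"
    and "\<delta> > 0"
  shows "\<exists>\<psi>\<in>A. apply_bcontfun \<psi> s = 1 \<and> (\<forall>t. cmod (\<psi> t) \<le> 1) \<and> (\<forall>t\<in>C. cmod (\<psi> t) \<le> \<delta>)"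
proof (cases "C = {}")
  case True
  then show ?thesis
    using uniform_algebraD(4)[OF A(1), of 1] by force
next
  case False
  have "compact (UNIV \<inter> C)" using K C(1) by (rule compact_Int_closed)
  then obtain t0 where t0: "t0 \<in> C" "\<And>t. t \<in> C \<Longrightarrow> cmod (\<phi> t) \<le> cmod (\<phi> t0)"
    using continuous_attains_sup[of C "\<lambda>t. cmod (\<phi> t)"] False by (auto intro: continuous_on_norm)
  define m where "m = cmod (\<phi> t0)"
  have m: "0 \<le> m" "m < norm \<phi>" "\<And>t. t \<in> C \<Longrightarrow> cmod (\<phi> t) \<le> m"
    using t0 C(2)[OF t0(1)] norm_bounded[of \<phi> t0] by (auto simp: m_def)
  have pos: "norm \<phi> > 0" using m by linarith
  obtain n where n: "(m / norm \<phi>) ^ n < \<delta>"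
    using real_arch_pow_inv[of \<delta> "m / norm \<phi>"] m pos \<open>\<delta> > 0\<close> by auto
  obtain \<psi> where \<psi>: "\<psi> \<in> A" "\<And>t. apply_bcontfun \<psi> t = (inverse (\<phi> s) * \<phi> t) ^ n"
    using uniform_algebra_power[OF A] by blast
  have norm_\<psi>: "cmod (\<psi> t) = (cmod (\<phi> t) / norm \<phi>) ^ n" for t
    by (simp add: \<psi>(2) norm_power norm_mult norm_inverse s divide_inverse mult.commute)
  have "\<phi> s \<noteq> 0" using s pos by auto
  then have "\<psi> s = 1" by (simp add: \<psi>(2))
  moreover have "cmod (\<psi> t) \<le> 1" for t
    unfolding norm_\<psi> using pos norm_bounded[of \<phi> t] by (intro power_le_one) auto
  moreover have "cmod (\<psi> t) \<le> \<delta>" if "t \<in> C" for t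
  proof -
    have "cmod (\<psi> t) \<le> (m / norm \<phi>) ^ n"
      unfolding norm_\<psi> using pos m(3)[OF that] by (intro power_mono divide_right_mono) auto
    with n show ?thesis by linarith
  qed
  ultimately show ?thesis using \<psi>(1) by blast
qed

section \<open>Functional calculus with the disc algebra\<close>

text \<open>The Taylor series of \<open>G\<close> need not converge uniformly up to the circle. The
  dilation \<open>G (r z)\<close> with \<open>r < 1\<close> is uniformly close to \<open>G\<close>,
  and its Taylor polynomials do converge uniformly on the closed disc.\<close>

lemma disc_polynomial_approximation:
  assumes cont: "continuous_on (cball 0 1) G" and hol: "G holomorphic_on ball 0 1" and "e > 0"
  shows "\<exists>c n. \<forall>z. cmod z \<le> 1 \<longrightarrow> dist (\<Sum>i<n. c i * z ^ i) (G z) \<le> e"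
proof -
  have "uniformly_continuous_on (cball 0 1) G"
    using cont by (intro compact_uniformly_continuous) auto
  then obtain d where d: "d > 0"
    "\<And>x y. x \<in> cball 0 1 \<Longrightarrow> y \<in> cball 0 1 \<Longrightarrow> dist y x < d \<Longrightarrow> dist (G y) (G x) < e/2"
    unfolding uniformly_continuous_on_def using \<open>e > 0\<close> by (metis half_gt_zero)
  define r where "r = 1 - min d 1 / 2"
  have r: "0 < r" "r < 1" "1 - r < d"
    using d(1) by (auto simp: r_def min_def)
  define a where "a n = (deriv ^^ n) G 0 / fact n" for n
  have sums: "(\<lambda>n. a n * z ^ n) sums G z" if "cmod z < 1" for z
    using holomorphic_power_series[OF hol, of z] that by (simp add: a_def)
  \<comment> \<open>Uniform convergence on \<open>cball 0 r\<close> requires a radius of convergence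
    strictly above \<open>r\<close>; convergence at the intermediate point \<open>r'\<close>
    provides it.\<close>
  define r' where "r' = (1 + r) / 2"
  have r': "r < r'" "r' < 1" using r by (auto simp: r'_def)
  have "summable (\<lambda>n. a n * of_real r' ^ n)"
    using sums[of "of_real r'"] r' r by (auto intro: sums_summable)
  then have "conv_radius a \<ge> norm (complex_of_real r')"
    by (rule conv_radius_geI)
  then have "ereal r < conv_radius a"
    using r r' by (auto intro: less_le_trans[of _ "ereal r'"])
  from powser_uniform_limit[OF this, of 0]
  have "\<forall>\<^sub>F n in sequentially. \<forall>z\<in>cball 0 r. dist (\<Sum>i<n. a i * z ^ i) (\<Sum>i. a i * z ^ i) < e/2"
    using \<open>e > 0\<close> by (auto dest: uniform_limitD[where e = "e/2"])
  then obtain n where n: "\<And>z. z \<in> cball 0 r \<Longrightarrow> dist (\<Sum>i<n. a i * z ^ i) (\<Sum>i. a i * z ^ i) < e/2"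
    unfolding eventually_sequentially by (meson order_refl)
  have "dist (\<Sum>i<n. (a i * of_real r ^ i) * z ^ i) (G z) \<le> e" if z: "cmod z \<le> 1" for z
  proof -
    have rz: "cmod (of_real r * z) \<le> r"
      using z r by (simp add: norm_mult mult_left_le)
    then have "dist (\<Sum>i<n. a i * (of_real r * z) ^ i) (G (of_real r * z)) < e/2"
      using n[of "of_real r * z"] sums[of "of_real r * z"] r by (simp add: sums_iff)
    moreover have "dist (G (of_real r * z)) (G z) < e/2"
    proof (rule d(2))
      have "dist (of_real r * z) z = (1 - r) * cmod z"
      proof -
        have "of_real r * z - z = - (of_real (1 - r) * z)" by (simp add: algebra_simps)
        then show ?thesis using r
          by (metis dist_norm norm_minus_cancel norm_mult norm_of_real abs_of_nonneg diff_ge_0_iff_ge less_imp_le)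
      qed
      also have "\<dots> \<le> 1 - r" using z r by (simp add: mult_left_le)
      finally show "dist (of_real r * z) z < d" using r by linarith
    qed (use z rz r in auto)
    ultimately have "dist (\<Sum>i<n. a i * (of_real r * z) ^ i) (G z) < e"
      by (smt (verit) dist_triangle field_sum_of_halves)
    then show ?thesis by (simp add: power_mult_distrib mult.assoc)
  qed
  then show ?thesis by (intro exI[of _ "\<lambda>i. a i * of_real r ^ i"] exI[of _ n]) blast
qed

text \<open>Polynomials in \<open>\<phi>\<close> lie in \<open>A\<close> and approximate
  \<open>G \<circ> \<phi>\<close> uniformly, because \<open>\<phi>\<close> maps into the closed
  disc; the limit stays in the closed set \<open>A\<close>.\<close>

lemma disc_algebra_calculus:
  fixes A :: "('k::topological_space \<Rightarrow>\<^sub>C complex) set"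
  assumes A: "uniform_algebra A" "\<phi> \<in> A" and \<phi>: "\<And>t. cmod (\<phi> t) \<le> 1"
    and cont: "continuous_on (cball 0 1) G" and hol: "G holomorphic_on ball 0 1"
  shows "\<exists>\<psi>\<in>A. \<forall>t. apply_bcontfun \<psi> t = G (\<phi> t)"
proof -
  have "continuous_on UNIV (\<lambda>t. G (\<phi> t))"
    using \<phi> by (intro continuous_on_compose2[OF cont]) auto
  moreover have "bounded (range (\<lambda>t. G (\<phi> t)))"
    using \<phi> by (intro bounded_subset[OF compact_imp_bounded[OF compact_continuous_image[OF cont]]]) auto
  ultimately have "(\<lambda>t. G (\<phi> t)) \<in> bcontfun"
    by (simp add: bcontfun_def)
  then obtain \<psi> where \<psi>: "(\<lambda>t. G (\<phi> t)) = apply_bcontfun \<psi>"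
    by (rule bcontfunE)
  have "\<exists>\<theta>\<in>A. dist \<theta> \<psi> < e" if e: "e > 0" for e
  proof -
    obtain c n where cn: "\<And>z. cmod z \<le> 1 \<Longrightarrow> dist (\<Sum>i<n. c i * z ^ i) (G z) \<le> e/2"
      using disc_polynomial_approximation[OF cont hol, of "e/2"] half_gt_zero[OF e] by blast
    obtain \<theta> where \<theta>: "\<theta> \<in> A" "\<forall>t. apply_bcontfun \<theta> t = (\<Sum>i<n. c i * \<phi> t ^ i)"
      using uniform_algebra_polynomial[OF A] by blast
    have "dist \<theta> \<psi> \<le> e/2"
      using cn \<phi> by (intro dist_bound) (simp add: \<theta>(2) fun_cong[OF \<psi>, symmetric])
    with e \<theta>(1) show ?thesis by (intro bexI[of _ \<theta>]) auto
  qed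
  then have "\<psi> \<in> A"
    using closed_approachable[OF uniform_algebraD(5)[OF A(1)]] by blast
  then show ?thesis using \<psi> by metis
qed

section \<open>The Shilov boundary\<close>

text \<open>The topology of the space is the weak topology induced by \<open>A\<close>: each point
  outside \<open>U\<close> has an element of \<open>A\<close> that vanishes at \<open>t\<close> and
  has modulus above 1 at that point, and compactness of \<open>- U\<close> leaves finitely many of
  them.\<close>

lemma uniform_algebra_weak_neighbourhood:
  fixes A :: "('k::t2_space \<Rightarrow>\<^sub>C complex) set"
  assumes K: "compact (UNIV :: 'k set)" and A: "uniform_algebra A" and U: "open U" "t \<in> U"
  shows "\<exists>D. finite D \<and> D \<subseteq> A \<and> t \<in> {s. \<forall>\<phi>\<in>D. cmod (\<phi> s) < 1} \<and> {s. \<forall>\<phi>\<in>D. cmod (\<phi> s) < 1} \<subseteq> U"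
proof -
  define D where "D = {\<phi>\<in>A. apply_bcontfun \<phi> t = 0}"
  have op: "open {s. 1 < cmod (apply_bcontfun \<phi> s)}" for \<phi> :: "'k \<Rightarrow>\<^sub>C complex"
    by (intro open_Collect_less continuous_on_norm) auto
  have "compact (UNIV \<inter> - U)"
    using K U by (intro compact_Int_closed) auto
  then have "compact (- U)" by simp
  moreover have "- U \<subseteq> (\<Union>\<phi>\<in>D. {s. 1 < cmod (apply_bcontfun \<phi> s)})"
  proof
    fix s assume "s \<in> - U"
    with U have "s \<noteq> t" by auto
    then obtain \<phi> where \<phi>: "\<phi> \<in> A" "\<phi> s \<noteq> \<phi> t"
      using uniform_algebraD(6)[OF A] by blast
    define \<psi> where "\<psi> = const_bcontfun (2 / (\<phi> s - \<phi> t)) \<odot> (\<phi> - const_bcontfun (\<phi> t))"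
    have \<psi>: "apply_bcontfun \<psi> r = 2 / (\<phi> s - \<phi> t) * (\<phi> r - \<phi> t)" for r
      by (simp add: \<psi>_def scaleC_complex_def)
    have "\<psi> \<in> A"
      unfolding \<psi>_def by (intro uniform_algebraD[OF A] \<phi>)
    then have "\<psi> \<in> D" by (simp add: D_def \<psi>)
    moreover have "\<psi> s = 2" using \<phi>(2) by (simp add: \<psi> field_simps)
    ultimately show "s \<in> (\<Union>\<phi>\<in>D. {s. 1 < cmod (apply_bcontfun \<phi> s)})"
      by (intro UN_I[of \<psi>]) auto
  qed
  ultimately obtain E where E: "E \<subseteq> D" "finite E" "- U \<subseteq> (\<Union>\<phi>\<in>E. {s. 1 < cmod (apply_bcontfun \<phi> s)})"
    using compactE_image[of "- U" D "\<lambda>\<phi>. {s. 1 < cmod (apply_bcontfun \<phi> s)}"] op by metis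
  show ?thesis
  proof (intro exI[of _ E] conjI)
    show "E \<subseteq> A" "t \<in> {s. \<forall>\<phi>\<in>E. cmod (\<phi> s) < 1}"
      using E(1) by (auto simp: D_def)
    show "{s. \<forall>\<phi>\<in>E. cmod (\<phi> s) < 1} \<subseteq> U"
      using E(3) by force
  qed (fact E(2))
qed

text \<open>Zorn's lemma for the open complements of closed boundaries. The union of a chain is
  again such a complement: the set where \<open>\<phi>\<close> attains its norm is compact, so if
  the union covered it, a single member of the chain would.\<close>

lemma minimal_boundary_exists:
  fixes A :: "('k::t2_space \<Rightarrow>\<^sub>C complex) set"
  assumes K: "compact (UNIV :: 'k set)"
  shows "\<exists>\<Gamma>. closed \<Gamma> \<and> is_boundary A \<Gamma> \<and> (\<forall>S. closed S \<and> is_boundary A S \<and> S \<subseteq> \<Gamma> \<longrightarrow> S = \<Gamma>)"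
proof -
  define \<C> where "\<C> = {V. open V \<and> is_boundary A (- V)}"
  have "\<exists>M\<in>\<C>. \<forall>X\<in>\<C>. M \<subseteq> X \<longrightarrow> X = M"
  proof (rule subset_Zorn_nonempty)
    have "{} \<in> \<C>"
      using bcontfun_attains_norm[OF K] by (auto simp: \<C>_def is_boundary_def)
    then show "\<C> \<noteq> {}" by blast
  next
    fix \<D> assume ne: "\<D> \<noteq> {}" and chain: "subset.chain \<C> \<D>"
    then have sub: "\<D> \<subseteq> \<C>" by (simp add: subset.chain_def)
    have "\<exists>t\<in>- \<Union>\<D>. cmod (apply_bcontfun \<phi> t) = norm \<phi>" if "\<phi> \<in> A" for \<phi>
    proof (rule ccontr)
      assume "\<not> ?thesis"
      then have cover: "{t\<in>UNIV. cmod (apply_bcontfun \<phi> t) = norm \<phi>} \<subseteq> \<Union>\<D>" by auto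
      have "\<And>V. V \<in> \<D> \<Longrightarrow> open V" using sub by (auto simp: \<C>_def)
      then obtain \<E> where \<E>: "\<E> \<subseteq> \<D>" "finite \<E>"
        "{t\<in>UNIV. cmod (apply_bcontfun \<phi> t) = norm \<phi>} \<subseteq> \<Union>\<E>"
        using compactE[OF compact_norm_eq[OF K closed_UNIV] cover] by blast
      have "\<E> \<noteq> {}"
        using \<E>(3) bcontfun_attains_norm[OF K, of \<phi>] by auto
      then have "\<Union>\<E> \<in> \<E>"
        using \<E>(1,2) chain by (intro Union_in_chain[of _ \<C>]) (simp_all add: subset.chain_def subset_iff)
      then have "is_boundary A (- \<Union>\<E>)"
        using \<E>(1) sub by (auto simp: \<C>_def)
      with that \<E>(3) show False by (auto simp: is_boundary_def)
    qed
    then show "\<Union>\<D> \<in> \<C>"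
      using sub by (auto simp: \<C>_def is_boundary_def)
  qed
  then obtain M where M: "M \<in> \<C>" "\<And>X. X \<in> \<C> \<Longrightarrow> M \<subseteq> X \<Longrightarrow> X = M" by blast
  have "S = - M" if "closed S" "is_boundary A S" "S \<subseteq> - M" for S
    using M(2)[of "- S"] that by (auto simp: \<C>_def)
  with M(1) show ?thesis
    by (intro exI[of _ "- M"]) (auto simp: \<C>_def)
qed

text \<open>By minimality the boundary without a basic neighbourhood \<open>V = {s. \<forall>\<theta>\<in>D. cmod (\<theta> s) < 1}\<close> is not
  a boundary. This gives \<open>\<psi>\<close> of norm 1 that is tiny on \<open>\<Gamma> - V\<close>, so that \<open>\<psi> \<theta>\<close> has norm less than 1 for
  \<open>\<theta> \<in> D\<close>; hence the peak set of \<open>\<psi>\<close>, taken in the whole space and not only in \<open>\<Gamma>\<close>, lies in \<open>V\<close>.\<close>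

lemma minimal_boundary_peak:
  fixes A :: "('k::t2_space \<Rightarrow>\<^sub>C complex) set"
  assumes K: "compact (UNIV :: 'k set)" and A: "uniform_algebra A"
    and \<Gamma>: "closed \<Gamma>" "is_boundary A \<Gamma>" "\<And>S. closed S \<Longrightarrow> is_boundary A S \<Longrightarrow> S \<subseteq> \<Gamma> \<Longrightarrow> S = \<Gamma>"
    and t: "t \<in> \<Gamma>" "open U" "t \<in> U"
  shows "\<exists>\<phi>\<in>A. {s. cmod (apply_bcontfun \<phi> s) = norm \<phi>} \<subseteq> U"
proof -
  obtain D where D: "finite D" "D \<subseteq> A" "t \<in> {s. \<forall>\<phi>\<in>D. cmod (\<phi> s) < 1}"
    "{s. \<forall>\<phi>\<in>D. cmod (\<phi> s) < 1} \<subseteq> U"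
    using uniform_algebra_weak_neighbourhood[OF K A t(2,3)] by blast
  define V where "V = {s. \<forall>\<phi>\<in>D. cmod (apply_bcontfun \<phi> s) < 1}"
  have "V = (\<Inter>\<phi>\<in>D. {s. cmod (apply_bcontfun \<phi> s) < 1})" by (auto simp: V_def)
  then have "open V"
    using D(1) by (auto intro!: open_INT open_Collect_less continuous_on_norm)
  have cl: "closed (\<Gamma> - V)" using \<Gamma>(1) \<open>open V\<close> by auto
  have "\<not> is_boundary A (\<Gamma> - V)"
    using \<Gamma>(3)[OF cl] t(1) D(3) by (auto simp: V_def)
  then obtain \<phi> where \<phi>: "\<phi> \<in> A" "\<And>s. s \<in> \<Gamma> - V \<Longrightarrow> cmod (\<phi> s) \<noteq> norm \<phi>"
    by (auto simp: is_boundary_def)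
  obtain s0 where s0: "s0 \<in> \<Gamma>" "cmod (\<phi> s0) = norm \<phi>"
    using \<Gamma>(2) \<phi>(1) by (auto simp: is_boundary_def)
  \<comment> \<open>The summand 1 makes \<open>B\<close> positive and strictly larger than every
    norm, so that \<open>1 / B * norm \<theta> < 1\<close>.\<close>
  define B where "B = 1 + (\<Sum>\<phi>\<in>D. norm \<phi>)"
  have B: "norm \<theta> < B" if "\<theta> \<in> D" for \<theta>
    using member_le_sum[OF that, of norm] D(1) by (simp add: B_def)
  have "B > 0" by (simp add: B_def add_pos_nonneg sum_nonneg)
  obtain \<psi> where \<psi>: "\<psi> \<in> A" "\<psi> s0 = 1" "\<And>s. cmod (\<psi> s) \<le> 1" "\<And>s. s \<in> \<Gamma> - V \<Longrightarrow> cmod (\<psi> s) \<le> 1 / B"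
    using peaking_function[OF K A \<phi>(1) s0(2) cl \<phi>(2), of "1 / B"] \<open>B > 0\<close> by auto
  have "norm \<psi> = 1"
    using norm_bounded[of \<psi> s0] \<psi>(2,3) by (intro antisym norm_bound) auto
  have "cmod (apply_bcontfun \<theta> s) < 1" if s: "cmod (\<psi> s) = norm \<psi>" and "\<theta> \<in> D" for s \<theta>
  proof -
    have "\<psi> \<odot> \<theta> \<in> A"
      using \<psi>(1) \<open>\<theta> \<in> D\<close> D(2) by (intro uniform_algebraD[OF A]) auto
    \<comment> \<open>It suffices to bound the product on \<open>\<Gamma>\<close>, where
      \<open>\<theta>\<close> is below 1 on \<open>V\<close> and \<open>\<psi>\<close> is tiny off
      \<open>V\<close>; the bound then holds on the whole space.\<close>
    then obtain r where r: "r \<in> \<Gamma>" "cmod (apply_bcontfun (\<psi> \<odot> \<theta>) r) = norm (\<psi> \<odot> \<theta>)"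
      using \<Gamma>(2) by (auto simp: is_boundary_def)
    have "cmod (\<psi> r) * cmod (apply_bcontfun \<theta> r) < 1"
    proof (cases "r \<in> V")
      case True
      then show ?thesis
        using \<psi>(3)[of r] \<open>\<theta> \<in> D\<close> 
        by (intro order_le_less_trans[OF mult_left_le_one_le]) (auto simp: V_def)
    next
      case False
      then have "cmod (\<psi> r) * cmod (apply_bcontfun \<theta> r) \<le> 1 / B * norm \<theta>"
        using \<psi>(4) r(1) \<open>B > 0\<close> by (intro mult_mono norm_bounded) auto
      also have "\<dots> < 1" using B[OF \<open>\<theta> \<in> D\<close>] \<open>B > 0\<close> by simp
      finally show ?thesis .
    qed
    then have "norm (\<psi> \<odot> \<theta>) < 1"
      using r(2) by (simp add: norm_scaleC)
    then show ?thesis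
      using norm_bounded[of "\<psi> \<odot> \<theta>" s] s \<open>norm \<psi> = 1\<close> by (simp add: norm_scaleC)
  qed
  then have "{s. cmod (\<psi> s) = norm \<psi>} \<subseteq> V" by (auto simp: V_def)
  with \<psi>(1) D(4) show ?thesis by (auto simp: V_def)
qed

text \<open>A minimal closed boundary is already the least one: a point of it outside a closed
  boundary \<open>S\<close> would give an element of \<open>A\<close> with peak set inside
  \<open>- S\<close>, which could not attain its norm on \<open>S\<close>. So the
  \<open>LEAST\<close> in \<open>shilov_boundary\<close> denotes it.\<close>

lemma shilov_boundary_peak:
  fixes A :: "('k::t2_space \<Rightarrow>\<^sub>C complex) set"
  assumes K: "compact (UNIV :: 'k set)" and A: "uniform_algebra A"
    and t: "t \<in> shilov_boundary A" "open U" "t \<in> U"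
  shows "\<exists>\<phi>\<in>A. {s. cmod (apply_bcontfun \<phi> s) = norm \<phi>} \<subseteq> U"
proof -
  obtain \<Gamma> where \<Gamma>: "closed \<Gamma>" "is_boundary A \<Gamma>"
    "\<And>S. closed S \<Longrightarrow> is_boundary A S \<Longrightarrow> S \<subseteq> \<Gamma> \<Longrightarrow> S = \<Gamma>"
    using minimal_boundary_exists[OF K, of A] by blast
  have "\<Gamma> \<subseteq> S" if S: "closed S" "is_boundary A S" for S
  proof (rule ccontr)
    assume "\<not> \<Gamma> \<subseteq> S"
    then obtain t where "t \<in> \<Gamma>" "t \<in> - S" by blast
    then obtain \<phi> where "\<phi> \<in> A" "{s. cmod (apply_bcontfun \<phi> s) = norm \<phi>} \<subseteq> - S"
      using minimal_boundary_peak[OF K A \<Gamma>, of t "- S"] S(1) by auto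
    with S(2) show False by (auto simp: is_boundary_def)
  qed
  then have "shilov_boundary A = \<Gamma>"
    unfolding shilov_boundary_def using \<Gamma>(1,2) by (intro Least_equality) auto
  with t show ?thesis
    using minimal_boundary_peak[OF K A \<Gamma>, of t U] by simp
qed

section \<open>Norm-attaining functions are Delta-points\<close>

text \<open>The disc automorphism \<open>(a - z) / (1 - a z)\<close> sends 1 to -1 for every real
  \<open>a\<close> in (0,1); as \<open>a\<close> tends to 1 it moves the whole disc of radius 1/2
  towards 1.\<close>

lemma moebius_pushing_centre:
  assumes "e > 0"
  shows "\<exists>M. continuous_on (cball 0 1) M \<and> M holomorphic_on ball 0 1 \<and> M 1 = -1 \<and>
    (\<forall>z. cmod z \<le> 1 \<longrightarrow> cmod (M z) \<le> 1) \<and> (\<forall>z. cmod z \<le> 1/2 \<longrightarrow> cmod (1 - M z) \<le> e)"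
proof -
  \<comment> \<open>On the disc of radius 1/2, \<open>|1 - M z| = b |1 + z| / |1 - a z|\<close> is
    at most \<open>3 b\<close>, whence the division by 3.\<close>
  define b where "b = min e 1 / 3"
  define a where "a = 1 - b"
  have b: "0 < b" "b \<le> 1/3" "3 * b \<le> e" using assms by (auto simp: b_def)
  have a: "0 < a" "a < 1" using b by (auto simp: a_def)
  have nz: "1 - of_real a * z \<noteq> 0" if "cmod z \<le> 1" for z :: complex
  proof
    assume "1 - of_real a * z = 0"
    then have "cmod (of_real a * z) = 1" by (metis eq_iff_diff_eq_0 norm_one)
    moreover have "cmod (of_real a * z) \<le> a * 1"
      using that a by (simp add: norm_mult)
    ultimately show False using a by simp
  qed
  define M where "M z = (of_real a - z) / (1 - of_real a * z)" for z :: complex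
  have "continuous_on (cball 0 1) M" "M holomorphic_on ball 0 1"
    unfolding M_def using nz by (auto intro!: continuous_intros holomorphic_intros)
  moreover have "M 1 = -1"
  proof -
    have "complex_of_real a \<noteq> 1" using a by simp
    then show ?thesis by (simp add: M_def divide_eq_eq)
  qed
  moreover have "cmod (M z) \<le> 1" if "cmod z \<le> 1" for z
  proof -
    have "(cmod z)\<^sup>2 \<le> 1" "a\<^sup>2 \<le> 1" using that a by (auto intro: power_le_one)
    \<comment> \<open>The bound rests on the identity
      \<open>|1 - a z|^2 - |a - z|^2 = (1 - a^2) (1 - |z|^2)\<close>.\<close>
    then have "0 \<le> (1 - a\<^sup>2) * (1 - (cmod z)\<^sup>2)" by simp
    also have "\<dots> = (1 - a * Re z)\<^sup>2 + (a * Im z)\<^sup>2 - ((a - Re z)\<^sup>2 + (Im z)\<^sup>2)"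
      by (simp only: cmod_power2) (simp add: power2_eq_square algebra_simps)
    also have "\<dots> = (cmod (1 - of_real a * z))\<^sup>2 - (cmod (of_real a - z))\<^sup>2"
      by (simp only: cmod_power2) simp
    finally have "(cmod (of_real a - z))\<^sup>2 \<le> (cmod (1 - of_real a * z))\<^sup>2"
      by linarith
    then have "cmod (of_real a - z) \<le> cmod (1 - of_real a * z)"
      by (rule power2_le_imp_le) (rule norm_ge_zero)
    then show ?thesis
      using nz[OF that] by (simp add: M_def norm_divide)
  qed
  moreover have "cmod (1 - M z) \<le> e" if z: "cmod z \<le> 1/2" for z
  proof -
    have "a * cmod z \<le> 1 * (1/2)" using z a by (intro mult_mono) auto
    then have den: "1/2 \<le> cmod (1 - of_real a * z)"
      using norm_triangle_ineq2[of 1 "of_real a * z"] a by (simp add: norm_mult)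
    have "1 - M z = of_real b * (1 + z) / (1 - of_real a * z)"
      using nz[of z] z by (simp add: M_def a_def field_simps)
    then have "cmod (1 - M z) = b * cmod (1 + z) / cmod (1 - of_real a * z)"
      using b by (simp add: norm_mult norm_divide)
    also have "\<dots> \<le> b * (3/2) / (1/2)"
      using norm_triangle_ineq[of 1 z] z b den by (intro frac_le mult_left_mono mult_nonneg_nonneg) auto
    finally show ?thesis using b by simp
  qed
  ultimately show ?thesis by blast
qed

text \<open>A point \<open>s\<close> of \<open>S\<close> in \<open>W\<close> other than
  \<open>t\<close> is separated from \<open>t\<close> by disjoint \<open>P\<close> and
  \<open>Q\<close>. The set \<open>W \<inter> P\<close> is one member of the family, and the others
  are found inside \<open>W \<inter> Q\<close>, still a neighbourhood of \<open>t\<close>.\<close>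

lemma islimpt_disjoint_open_sets:
  fixes t :: "'k::t2_space"
  assumes "t islimpt S" "open W" "t \<in> W"
  shows "\<exists>U :: nat \<Rightarrow> 'k set. (\<forall>i<n. open (U i) \<and> U i \<subseteq> W \<and> U i \<inter> S \<noteq> {}) \<and> disjoint_family_on U {..<n}"
  using assms(2,3)
proof (induction n arbitrary: W)
  case 0
  show ?case by (simp add: disjoint_family_on_def)
next
  case (Suc n)
  obtain s where s: "s \<in> S" "s \<in> W" "s \<noteq> t"
    using islimptE[OF assms(1) Suc.prems(2,1)] .
  obtain P Q where PQ: "open P" "open Q" "s \<in> P" "t \<in> Q" "P \<inter> Q = {}"
    using hausdorff[OF s(3)] by blast
  obtain U where U: "\<forall>i<n. open (U i) \<and> U i \<subseteq> W \<inter> Q \<and> U i \<inter> S \<noteq> {}" "disjoint_family_on U {..<n}"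
    using Suc.IH[of "W \<inter> Q"] Suc.prems PQ by auto
  define U' where "U' = U(n := W \<inter> P)"
  have "open (U' i) \<and> U' i \<subseteq> W \<and> U' i \<inter> S \<noteq> {}" if "i < Suc n" for i
    using U(1) that Suc.prems s PQ by (cases "i = n") (auto simp: U'_def less_Suc_eq)
  moreover have "disjoint_family_on U' {..<Suc n}"
    unfolding disjoint_family_on_def
  proof (intro ballI impI)
    fix i j assume "i \<in> {..<Suc n}" "j \<in> {..<Suc n}" "i \<noteq> j"
    then consider "i < n" "j < n" | "i = n" "j < n" | "i < n" "j = n" by fastforce
    then show "U' i \<inter> U' j = {}"
    proof cases
      case 1
      then show ?thesis
        using U(2) \<open>i \<noteq> j\<close> by (simp add: U'_def disjoint_family_on_def)
    next
      case 2
      then have "U j \<subseteq> Q" using U(1) by blast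
      with 2 PQ(5) show ?thesis by (auto simp: U'_def)
    next
      case 3
      then have "U i \<subseteq> Q" using U(1) by blast
      with 3 PQ(5) show ?thesis by (auto simp: U'_def)
    qed
  qed
  ultimately show ?case by blast
qed

lemma apply_bcontfun_sum:
  "apply_bcontfun (\<Sum>i\<in>I. f i) t = (\<Sum>i\<in>I. apply_bcontfun (f i) t)"
  by (induction I rule: infinite_finite_induct) auto

text \<open>Reflecting \<open>f\<close> to \<open>- f\<close> near one of n points of the Shilov boundary that lie close to \<open>t\<close>, in
  disjoint neighbourhoods, gives n functions at distance almost 2 from \<open>f\<close> whose mean is
  uniformly within O(1/n) of \<open>f\<close>.\<close>

lemma Delta_point_if_norm_attained_at_limit_point:
  fixes F :: "('k::t2_space \<Rightarrow>\<^sub>C 'x::complex_normed_vector) set"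
  assumes K: "compact (UNIV :: 'k set)" and A: "uniform_algebra A"
    and module: "\<And>\<phi> f. \<phi> \<in> A \<Longrightarrow> f \<in> F \<Longrightarrow> \<phi> \<odot> f \<in> F"
    and t: "t islimpt shilov_boundary A"
    and f: "f \<in> F" "norm f = 1" "norm (apply_bcontfun f t) = 1"
  shows "f \<in> Delta_points F"
proof -
  have "f \<in> closure (convex hull diametral_set F \<epsilon> f)" if "\<epsilon> > 0" for \<epsilon>
    unfolding closure_approachable
  proof (intro allI impI)
    fix e :: real assume "e > 0"
    obtain M where M: "continuous_on (cball 0 1) M" "M holomorphic_on ball 0 1" "M 1 = -1"
      "\<And>z. cmod z \<le> 1 \<Longrightarrow> cmod (M z) \<le> 1" "\<And>z. cmod z \<le> 1/2 \<Longrightarrow> cmod (1 - M z) \<le> e/4"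
      using moebius_pushing_centre[of "e/4"] \<open>e > 0\<close> by auto
    \<comment> \<open>At each point at most one \<open>\<psi> i\<close> is far from 1, adding at
      most \<open>2 / n\<close> to the error of the mean; this choice makes that at most
      \<open>e/4\<close>.\<close>
    obtain n :: nat where n: "8 / e < real n"
      using reals_Archimedean2 by blast
    then have n0: "0 < real n" using \<open>e > 0\<close> by (meson divide_pos_pos less_trans zero_less_numeral)
    \<comment> \<open>If \<open>\<psi> i\<close> is -1 at a point \<open>s\<close> of
      \<open>W\<close>, then \<open>f - \<psi> i \<odot> f\<close> has norm
      \<open>2 * norm (f s) > 2 - \<epsilon>\<close> there.\<close>
    define W where "W = {s. 1 - \<epsilon>/2 < norm (apply_bcontfun f s)}"
    have "open W"
      unfolding W_def by (intro open_Collect_less continuous_on_norm) auto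
    moreover have "t \<in> W" using f(3) \<open>\<epsilon> > 0\<close> by (simp add: W_def)
    ultimately obtain U where U: "\<And>i. i < n \<Longrightarrow> open (U i) \<and> U i \<subseteq> W \<and> U i \<inter> shilov_boundary A \<noteq> {}"
      "disjoint_family_on U {..<n}"
      using islimpt_disjoint_open_sets[OF t] by metis
    have "\<exists>\<psi>\<in>A. (\<exists>s\<in>W. apply_bcontfun \<psi> s = -1) \<and> (\<forall>s. cmod (\<psi> s) \<le> 1) \<and>
        (\<forall>s. s \<notin> U i \<longrightarrow> cmod (1 - \<psi> s) \<le> e/4)" if i: "i < n" for i
    proof -
      obtain \<phi> where \<phi>: "\<phi> \<in> A" "{s. cmod (apply_bcontfun \<phi> s) = norm \<phi>} \<subseteq> U i"
        using U(1)[OF i] shilov_boundary_peak[OF K A] by blast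
      \<comment> \<open>This point need not lie in the Shilov boundary; it only has to lie in
        \<open>U i\<close>, which contains the whole peak set.\<close>
      obtain s where s: "cmod (\<phi> s) = norm \<phi>"
        using bcontfun_attains_norm[OF K] by blast
      with \<phi>(2) U(1)[OF i] have "s \<in> W" by blast
      have cl: "closed (- U i)" using U(1)[OF i] by auto
      have off: "cmod (\<phi> r) \<noteq> norm \<phi>" if "r \<in> - U i" for r
        using \<phi>(2) that by auto
      obtain \<theta> where \<theta>: "\<theta> \<in> A" "\<theta> s = 1" "\<And>r. cmod (\<theta> r) \<le> 1"
        "\<And>r. r \<notin> U i \<Longrightarrow> cmod (\<theta> r) \<le> 1/2"
        using peaking_function[OF K A \<phi>(1) s cl off, of "1/2"] by auto
      obtain \<psi> where \<psi>: "\<psi> \<in> A" "\<And>r. apply_bcontfun \<psi> r = M (\<theta> r)"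
        using disc_algebra_calculus[OF A \<theta>(1,3) M(1,2)] by blast
      show ?thesis
        using \<psi>(1) \<open>s \<in> W\<close> \<theta>(2-4) M(3-5)
        by (intro bexI[of _ \<psi>] conjI bexI[of _ s]) (auto simp: \<psi>(2))
    qed
    then obtain \<psi> where \<psi>: "\<And>i. i < n \<Longrightarrow> \<psi> i \<in> A" "\<And>i. i < n \<Longrightarrow> \<exists>s\<in>W. apply_bcontfun (\<psi> i) s = -1"
      "\<And>i s. i < n \<Longrightarrow> cmod (apply_bcontfun (\<psi> i) s) \<le> 1"
      "\<And>i s. i < n \<Longrightarrow> s \<notin> U i \<Longrightarrow> cmod (1 - apply_bcontfun (\<psi> i) s) \<le> e/4"
      by metis
    have f_le: "norm (f s) \<le> 1" for s using norm_bounded[of f s] f(2) by simp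
    have diam: "\<psi> i \<odot> f \<in> diametral_set F \<epsilon> f" if i: "i < n" for i
    proof -
      have "norm (\<psi> i \<odot> f) \<le> 1"
        using \<psi>(3)[OF i] f_le by (intro norm_bound) (auto simp: norm_scaleC intro: mult_le_one)
      moreover obtain s where s: "s \<in> W" "apply_bcontfun (\<psi> i) s = -1"
        using \<psi>(2)[OF i] by blast
      have "(f - \<psi> i \<odot> f) s = 2 *\<^sub>R f s"
        using scaleC_of_real[of "-1" "f s"] by (simp add: s(2) scaleR_2)
      then have "2 * norm (f s) \<le> norm (f - \<psi> i \<odot> f)"
        using norm_bounded[of "f - \<psi> i \<odot> f" s] by simp
      then have "2 - \<epsilon> \<le> norm (f - \<psi> i \<odot> f)"
        using s(1) by (simp add: W_def)
      ultimately show ?thesis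
        using module[OF \<psi>(1)[OF i] f(1)] by (simp add: diametral_set_def)
    qed
    define y where "y = (\<Sum>i<n. (1 / real n) *\<^sub>R (\<psi> i \<odot> f))"
    have "y \<in> convex hull diametral_set F \<epsilon> f"
      unfolding y_def using n0 diam by (intro convex_sum) (auto intro: hull_inc)
    moreover have "dist y f < e"
    proof -
      have "norm ((f - y) s) \<le> e/2" for s
      proof -
        have "(f - y) s = (\<Sum>i<n. (1 / real n) *\<^sub>R f s) - (\<Sum>i<n. (1 / real n) *\<^sub>R (\<psi> i s *\<^sub>C f s))"
          using n0 by (simp add: y_def apply_bcontfun_sum sum_constant_scaleR)
        also have "\<dots> = (\<Sum>i<n. (1 / real n) *\<^sub>R ((1 - \<psi> i s) *\<^sub>C f s))"
          by (simp add: sum_subtractf[symmetric] complex_vector.scale_left_diff_distrib scaleR_diff_right)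
        also have "norm \<dots> \<le> (\<Sum>i<n. (1 / real n) * (e/4 + (if s \<in> U i then 2 else 0)))"
        proof (rule sum_norm_le)
          fix i assume "i \<in> {..<n}"
          then have "cmod (1 - \<psi> i s) \<le> e/4 + (if s \<in> U i then 2 else 0)"
            using \<psi>(3)[of i s] \<psi>(4)[of i s] \<open>e > 0\<close> norm_triangle_ineq4[of 1 "\<psi> i s"] by auto
          then have "cmod (1 - \<psi> i s) * norm (f s) \<le> e/4 + (if s \<in> U i then 2 else 0)"
            using f_le[of s] by (meson mult_right_le_one_le norm_ge_zero order_trans)
          then show "norm ((1 / real n) *\<^sub>R ((1 - \<psi> i s) *\<^sub>C f s)) \<le> (1 / real n) * (e/4 + (if s \<in> U i then 2 else 0))"
            using n0 by (simp add: norm_scaleC divide_right_mono)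
        qed
        also have "\<dots> = e/4 + (\<Sum>i<n. if s \<in> U i then 2 else 0) / real n"
          using n0 by (simp add: sum_distrib_left[symmetric] sum.distrib add_divide_distrib sum_divide_distrib[symmetric])
        also have "(\<Sum>i<n. if s \<in> U i then 2 else 0) = 2 * real (card {i\<in>{..<n}. s \<in> U i})"
          by (simp add: sum.If_cases Int_def)
        also have "e/4 + 2 * real (card {i\<in>{..<n}. s \<in> U i}) / real n \<le> e/4 + 2 / real n"
        proof -
          have "card {i\<in>{..<n}. s \<in> U i} \<le> 1"
            using U(2) by (auto simp: card_le_Suc0_iff_eq disjoint_family_on_def)
          then show ?thesis using n0 by (simp add: divide_right_mono)
        qed
        also have "\<dots> \<le> e/2"
          using n n0 \<open>e > 0\<close> by (simp add: field_simps)
        finally show ?thesis .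
      qed
      then have "norm (f - y) \<le> e/2" by (rule norm_bound)
      with \<open>e > 0\<close> show ?thesis by (simp add: dist_norm norm_minus_commute)
    qed
    ultimately show "\<exists>y\<in>convex hull diametral_set F \<epsilon> f. dist y f < e" by blast
  qed
  with f show ?thesis by (simp add: Delta_points_def)
qed

section \<open>Peak functions with values in a Stolz region\<close>

text \<open>Since \<open>1 - z\<close> has nonnegative real part and modulus at most 2, a small
  power of it lies in a thin sector about the positive axis with modulus at most slightly above 1.
  \<open>G\<close> is 1 minus that power.\<close>

lemma stolz_function:
  assumes e: "0 < e" "e \<le> 1"
  shows "\<exists>G. continuous_on (cball 0 1) G \<and> G holomorphic_on ball 0 1 \<and> G 0 = 0 \<and> G 1 = 1 \<and>
    (\<forall>z. cmod z \<le> 1 \<longrightarrow> cmod (G z) + (1 - e) * cmod (1 - G z) \<le> 1)"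
proof -
  \<comment> \<open>With \<open>e = 8 \<alpha>\<close>, the loss of \<open>2 \<alpha>\<close> from
    the angle leaves a factor \<open>1 - 6 \<alpha>\<close>, which outweighs the possible excess
    \<open>2 \<alpha>\<close> of the modulus over 1.\<close>
  define \<alpha> where "\<alpha> = e / 8"
  have \<alpha>: "0 < \<alpha>" "\<alpha> \<le> 1" using e by (auto simp: \<alpha>_def)
  define P where "P z = (1 - z) powr complex_of_real \<alpha>" for z
  have re: "Re z \<le> 1" if "cmod z \<le> 1" for z
    using complex_Re_le_cmod[of z] that by linarith
  \<comment> \<open>At \<open>z = 1\<close> the base of the power is 0; continuity there uses
    \<open>\<alpha> > 0\<close> and the nonnegative real part of \<open>1 - z\<close>.\<close>
  have cont: "continuous_on (cball 0 1) P"
    unfolding P_def using re \<alpha> by (intro continuous_intros) auto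
  have hol: "P holomorphic_on ball 0 1"
  proof -
    have "1 - z \<notin> \<real>\<^sub>\<le>\<^sub>0" if "cmod z < 1" for z
      using complex_Re_le_cmod[of z] that by (auto simp: complex_nonpos_Reals_iff)
    then show ?thesis
      unfolding P_def by (intro holomorphic_intros) auto
  qed
  have bound: "cmod (1 - P z) + (1 - e) * cmod (P z) \<le> 1" if z: "cmod z \<le> 1" for z
  proof (cases "z = 1")
    case True
    then show ?thesis by (simp add: P_def)
  next
    case False
    define \<rho> where "\<rho> = cmod (P z)"
    define \<theta> where "\<theta> = \<alpha> * Im (Ln (1 - z))"
    have "cmod (1 - z) \<le> 2" using norm_triangle_ineq4[of 1 z] z by simp
    have \<rho>_eq: "\<rho> = cmod (1 - z) powr \<alpha>"
      by (simp add: \<rho>_def P_def norm_powr_real_powr')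
    also have "\<dots> \<le> 2 powr \<alpha>"
      using \<open>cmod (1 - z) \<le> 2\<close> \<alpha> by (intro powr_mono2) auto
    also have "\<dots> \<le> exp \<alpha>"
      using \<alpha> ln_2_less_1 by (simp add: powr_def)
    also have "\<dots> \<le> 1 + \<alpha> + \<alpha>\<^sup>2"
      using \<alpha> by (intro exp_bound) auto
    also have "\<dots> \<le> 1 + 2 * \<alpha>"
      using \<alpha> power_decreasing[of 1 2 \<alpha>] by simp
    finally have \<rho>: "0 \<le> \<rho>" "\<rho> \<le> 1 + 2 * \<alpha>" by (auto simp: \<rho>_def)
    have "\<bar>Im (Ln (1 - z))\<bar> \<le> pi / 2"
      using Re_Ln_pos_le[of "1 - z"] False re[OF z] by simp
    then have "\<bar>Im (Ln (1 - z))\<bar> \<le> 2" using pi_less_4 by linarith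
    then have "\<bar>\<theta>\<bar> \<le> \<alpha> * 2"
      unfolding \<theta>_def abs_mult using \<alpha> by (intro mult_mono) auto
    have "of_real \<alpha> * Ln (1 - z) = of_real (\<alpha> * Re (Ln (1 - z))) + \<i> * of_real \<theta>"
      by (simp add: \<theta>_def complex_eq_iff)
    then have "P z = exp (of_real (\<alpha> * Re (Ln (1 - z))) + \<i> * of_real \<theta>)"
      using False by (simp add: P_def powr_def)
    also have "\<dots> = of_real (exp (\<alpha> * Re (Ln (1 - z)))) * exp (\<i> * of_real \<theta>)"
      by (simp only: exp_add exp_of_real)
    finally have Pz: "P z = of_real (exp (\<alpha> * Re (Ln (1 - z)))) * exp (\<i> * of_real \<theta>)" .
    have "\<rho> = exp (\<alpha> * Re (Ln (1 - z)))"
      by (simp add: \<rho>_def Pz norm_mult)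
    with Pz have "P z = of_real \<rho> * exp (\<i> * of_real \<theta>)" by simp
    then have "1 - P z = of_real (1 - \<rho>) - of_real \<rho> * (exp (\<i> * of_real \<theta>) - 1)"
      by (simp add: algebra_simps)
    then have "cmod (1 - P z) \<le> \<bar>1 - \<rho>\<bar> + \<rho> * cmod (exp (\<i> * of_real \<theta>) - 1)"
      using norm_triangle_ineq4[of "complex_of_real (1 - \<rho>)" "of_real \<rho> * (exp (\<i> * of_real \<theta>) - 1)"] \<rho>(1)
      by (simp only: norm_mult norm_of_real abs_of_nonneg)
    \<comment> \<open>The chord has length \<open>2 |sin (\<theta> / 2)|\<close>, at most
      \<open>|\<theta>|\<close>.\<close>
    also have "\<dots> \<le> \<bar>1 - \<rho>\<bar> + \<rho> * (\<alpha> * 2)"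
      using \<open>\<bar>\<theta>\<bar> \<le> \<alpha> * 2\<close> abs_sin_x_le_abs_x[of "\<theta> / 2"] \<rho>(1)
      by (intro add_left_mono mult_left_mono) (auto simp: dist_exp_i_1)
    finally have *: "cmod (1 - P z) + (1 - e) * \<rho> \<le> \<bar>1 - \<rho>\<bar> + \<rho> * (1 - 6 * \<alpha>)"
      by (simp add: \<alpha>_def algebra_simps)
    also have "\<dots> \<le> 1"
    proof (cases "\<rho> \<le> 1")
      case True
      with \<rho>(1) \<alpha> show ?thesis by (simp add: algebra_simps)
    next
      case False
      have "\<rho> * (2 - 6 * \<alpha>) \<le> (1 + 2 * \<alpha>) * (2 - 6 * \<alpha>)"
        using \<rho>(2) e by (intro mult_right_mono) (auto simp: \<alpha>_def)
      also have "\<dots> \<le> 2" using \<alpha> by (simp add: algebra_simps)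
      finally show ?thesis using False by (simp add: algebra_simps)
    qed
    finally show ?thesis by (simp add: \<rho>_def)
  qed
  show ?thesis
  proof (intro exI conjI allI impI)
    show "continuous_on (cball 0 1) (\<lambda>z. 1 - P z)"
      using cont by (intro continuous_intros)
    show "(\<lambda>z. 1 - P z) holomorphic_on ball 0 1"
      using hol by (intro holomorphic_intros)
    show "1 - P 0 = 0" "1 - P 1 = 1"
      by (simp_all add: P_def)
    show "cmod (1 - P z) + (1 - e) * cmod (1 - (1 - P z)) \<le> 1" if "cmod z \<le> 1" for z
      using bound[OF that] by simp
  qed
qed

text \<open>The set \<open>- {t}\<close> is an open neighbourhood of \<open>t0\<close> with
  complement \<open>{t}\<close>, so for it the supremum is just the value at
  \<open>t\<close>.\<close>

lemma strong_peak_point_peak: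
  fixes A :: "('k::t2_space \<Rightarrow>\<^sub>C complex) set"
  assumes "t0 \<in> strong_peak_points A"
  shows "\<exists>\<phi>\<in>A. cmod (apply_bcontfun \<phi> t0) = norm \<phi> \<and> (\<forall>t. t \<noteq> t0 \<longrightarrow> cmod (\<phi> t) \<noteq> norm \<phi>)"
proof -
  obtain \<phi> where \<phi>: "\<phi> \<in> A" "cmod (\<phi> t0) = norm \<phi>"
    "\<And>U. open U \<Longrightarrow> t0 \<in> U \<Longrightarrow> U \<noteq> UNIV \<Longrightarrow> (SUP t\<in>UNIV - U. cmod (apply_bcontfun \<phi> t)) < norm \<phi>"
    using assms by (auto simp: strong_peak_points_def)
  have "cmod (\<phi> t) \<noteq> norm \<phi>" if "t \<noteq> t0" for t
  proof -
    have "UNIV - - {t} = {t}" by auto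
    moreover have "open (- {t})" "t0 \<in> - {t}" "- {t} \<noteq> UNIV" using that by auto
    ultimately show ?thesis using \<phi>(3)[of "- {t}"] by simp
  qed
  with \<phi> show ?thesis by blast
qed

section \<open>The convex diametral local diameter two property\<close>

lemma scaleC_subspace_imp_subspace:
  assumes "complex_vector.subspace F"
  shows "subspace F"
  using assms scaleC_of_real unfolding complex_vector.subspace_def subspace_def by metis

lemma unit_vector_direction:
  fixes x :: "'x::real_normed_vector"
  assumes "\<exists>v::'x. v \<noteq> 0"
  shows "\<exists>u. norm u = 1 \<and> x = norm x *\<^sub>R u"
proof (cases "x = 0")
  case True
  obtain v :: 'x where "v \<noteq> 0" using assms by blast
  with True show ?thesis by (intro exI[of _ "v /\<^sub>R norm v"]) simp
next
  case False
  then show ?thesis by (intro exI[of _ "x /\<^sub>R norm x"]) simp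
qed

text \<open>Near the peak point \<open>t0\<close>, with \<open>f t0 = r u\<close> for a unit vector \<open>u\<close>, the function \<open>f\<close> is a convex
  combination, up to a small error, of \<open>(1 - \<eta>) (1 - h) f \<plusminus> h u\<close>. The Stolz condition on \<open>h\<close>
  keeps both in the unit ball, and both have norm 1 at \<open>t0\<close>.\<close>

lemma approx_norm_attained_at_peak_point:
  fixes F :: "('k::t2_space \<Rightarrow>\<^sub>C 'x::complex_normed_vector) set"
  assumes K: "compact (UNIV :: 'k set)" and A: "uniform_algebra A"
    and F: "subspace F" and module: "\<And>\<phi> f. \<phi> \<in> A \<Longrightarrow> f \<in> F \<Longrightarrow> \<phi> \<odot> f \<in> F"
    and tensors: "elementary_tensors A \<subseteq> F" and nontrivial: "\<exists>v::'x. v \<noteq> 0"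
    and t0: "t0 \<in> strong_peak_points A"
    and f: "f \<in> F" "norm f \<le> 1" and "e > 0"
  shows "\<exists>y\<in>convex hull {g\<in>F. norm g = 1 \<and> norm (apply_bcontfun g t0) = 1}. dist y f < e"
proof -
  \<comment> \<open>The final error is at most \<open>4 * \<eta>\<close>, so a fifth of
    \<open>e\<close> leaves a strict inequality; \<open>stolz_function\<close> requires the cap at
    1.\<close>
  define \<eta> where "\<eta> = min (e/5) 1"
  have \<eta>: "0 < \<eta>" "\<eta> \<le> 1" "4 * \<eta> < e" using \<open>e > 0\<close> by (auto simp: \<eta>_def)
  obtain G where G: "continuous_on (cball 0 1) G" "G holomorphic_on ball 0 1" "G 0 = 0" "G 1 = 1"
    "\<And>z. cmod z \<le> 1 \<Longrightarrow> cmod (G z) + (1 - \<eta>) * cmod (1 - G z) \<le> 1"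
    using stolz_function[OF \<eta>(1,2)] by blast
  \<comment> \<open>As \<open>G 0 = 0\<close>, continuity at 0 turns smallness of
    \<open>\<theta>\<close> off \<open>U\<close> into smallness of \<open>h\<close>.\<close>
  obtain \<delta> where \<delta>: "\<delta> > 0" "\<And>z. cmod z \<le> 1 \<Longrightarrow> cmod z < \<delta> \<Longrightarrow> cmod (G z) < \<eta>"
    using G(1)[unfolded continuous_on_iff, rule_format, of 0 \<eta>] G(3) \<eta>(1) by (auto simp: dist_norm)
  define x where "x = f t0"
  \<comment> \<open>If \<open>f t0 = 0\<close>, any unit vector serves as \<open>u\<close>, and the
    weights in \<open>y\<close> are both 1/2.\<close>
  obtain u where u: "norm u = 1" "x = norm x *\<^sub>R u"
    using unit_vector_direction[OF nontrivial] by blast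
  define r where "r = norm x"
  have f_le: "norm (f s) \<le> 1" for s using norm_bounded[of f s] f(2) by linarith
  have r: "0 \<le> r" "r \<le> 1" using f_le[of t0] by (auto simp: r_def x_def)
  define U where "U = {s. norm (x - f s) < \<eta>}"
  have "open U"
    unfolding U_def by (intro open_Collect_less continuous_intros) auto
  then have cl: "closed (- U)" by auto
  have "t0 \<in> U" using \<eta>(1) by (simp add: U_def x_def)
  obtain \<phi> where \<phi>: "\<phi> \<in> A" "cmod (\<phi> t0) = norm \<phi>" "\<And>t. t \<noteq> t0 \<Longrightarrow> cmod (\<phi> t) \<noteq> norm \<phi>"
    using strong_peak_point_peak[OF t0] by blast
  have off: "cmod (\<phi> t) \<noteq> norm \<phi>" if "t \<in> - U" for t
    using that \<open>t0 \<in> U\<close> by (intro \<phi>(3)) auto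
  obtain \<theta> where \<theta>: "\<theta> \<in> A" "\<theta> t0 = 1" "\<And>s. cmod (\<theta> s) \<le> 1"
    "\<And>s. s \<notin> U \<Longrightarrow> cmod (\<theta> s) \<le> \<delta> / 2"
    using peaking_function[OF K A \<phi>(1,2) cl off, of "\<delta> / 2"] \<delta>(1) by auto
  obtain h where h: "h \<in> A" "\<And>s. apply_bcontfun h s = G (\<theta> s)"
    using disc_algebra_calculus[OF A \<theta>(1,3) G(1,2)] by blast
  have h0: "h t0 = 1" by (simp add: h(2) \<theta>(2) G(4))
  have stolz: "cmod (h s) + (1 - \<eta>) * cmod (1 - h s) \<le> 1" for s
    using G(5)[OF \<theta>(3)] by (simp add: h(2))
  have h_le: "cmod (h s) \<le> 1" for s
  proof -
    have "0 \<le> (1 - \<eta>) * cmod (1 - h s)" using \<eta>(2) by (intro mult_nonneg_nonneg) auto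
    with stolz[of s] show ?thesis by linarith
  qed
  have h_off: "cmod (h s) \<le> \<eta>" if "s \<notin> U" for s
    using \<delta>(2)[of "\<theta> s"] \<theta>(3)[of s] \<theta>(4)[OF that] \<delta>(1) by (simp add: h(2))
  define p where "p = (1 - \<eta>) *\<^sub>R (f - h \<odot> f)"
  define H where "H = h \<odot> const_bcontfun u"
  have p: "p s = (1 - \<eta>) *\<^sub>R ((1 - h s) *\<^sub>C f s)" for s
    by (simp add: p_def complex_vector.scale_left_diff_distrib)
  have H: "H s = h s *\<^sub>C u" for s
    by (simp add: H_def)
  have "p \<in> F"
    unfolding p_def by (intro subspace_scale[OF F] subspace_diff[OF F] f module h)
  moreover have "H \<in> F"
    using tensors h(1) by (auto simp: H_def elementary_tensors_def)
  ultimately have mem: "p + H \<in> F" "p - H \<in> F"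
    by (auto intro: subspace_add[OF F] subspace_diff[OF F])
  have le: "norm (p s) + norm (H s) \<le> 1" for s
  proof -
    have "(1 - \<eta>) * (cmod (1 - h s) * norm (f s)) \<le> (1 - \<eta>) * cmod (1 - h s)"
      using \<eta>(2) f_le by (intro mult_left_mono) (auto intro: mult_right_le_one_le)
    then show ?thesis
      using stolz[of s] \<eta>(2) u(1) by (simp add: p H norm_scaleC)
  qed
  have "norm (p + H) \<le> 1" "norm (p - H) \<le> 1"
    by (auto intro!: norm_bound order_trans[OF norm_triangle_ineq le] order_trans[OF norm_triangle_ineq4 le])
  moreover have at_t0: "(p + H) t0 = u" "(p - H) t0 = - u"
    by (simp_all add: p H h0)
  moreover have "1 \<le> norm (p + H)" "1 \<le> norm (p - H)"
    using norm_bounded[of "p + H" t0] norm_bounded[of "p - H" t0] u(1) by (simp_all only: at_t0 norm_minus_cancel)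
  ultimately have attained: "p + H \<in> {g\<in>F. norm g = 1 \<and> norm (apply_bcontfun g t0) = 1}"
    "p - H \<in> {g\<in>F. norm g = 1 \<and> norm (apply_bcontfun g t0) = 1}"
    using mem u(1) by (auto simp only: mem_Collect_eq norm_minus_cancel intro: antisym)
  \<comment> \<open>The weights give \<open>y = p + r *\<^sub>R H\<close>, whose value at
    \<open>t0\<close> is \<open>r *\<^sub>R u = f t0\<close>.\<close>
  define y where "y = ((1 + r) / 2) *\<^sub>R (p + H) + ((1 - r) / 2) *\<^sub>R (p - H)"
  have "y \<in> convex hull {g\<in>F. norm g = 1 \<and> norm (apply_bcontfun g t0) = 1}"
    unfolding y_def using r hull_inc[OF attained(1)] hull_inc[OF attained(2)]
    by (intro convexD[OF convex_convex_hull]) (auto simp: field_simps)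
  moreover have "dist y f < e"
  proof -
    have "norm ((y - f) s) \<le> 4 * \<eta>" for s
    proof -
      have "y = p + r *\<^sub>R H"
      proof -
        have "y = ((1 + r) / 2 + (1 - r) / 2) *\<^sub>R p + ((1 + r) / 2 - (1 - r) / 2) *\<^sub>R H"
          unfolding y_def by (simp only: algebra_simps)
        then show ?thesis by (simp add: diff_divide_distrib[symmetric] add_divide_distrib[symmetric])
      qed
      then have "(y - f) s = (1 - \<eta>) *\<^sub>R ((1 - h s) *\<^sub>C f s) + h s *\<^sub>C x - f s"
        using u(2) by (simp add: p H r_def bounded_bilinear.scaleR_right[OF bounded_bilinear_scaleC, symmetric])
      \<comment> \<open>The first term is small on \<open>U\<close> because \<open>f\<close> is
        close to \<open>x\<close> there, and off \<open>U\<close> because \<open>h\<close> is small;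
        the second carries the factor \<open>\<eta>\<close>.\<close>
      also have "\<dots> = h s *\<^sub>C (x - f s) - \<eta> *\<^sub>R ((1 - h s) *\<^sub>C f s)"
        by (simp add: algebra_simps)
      finally have "norm ((y - f) s) \<le> cmod (h s) * norm (x - f s) + \<eta> * (cmod (1 - h s) * norm (f s))"
        using norm_triangle_ineq4[of "h s *\<^sub>C (x - f s)" "\<eta> *\<^sub>R ((1 - h s) *\<^sub>C f s)"] \<eta>(1)
        by (simp add: norm_scaleC)
      also have "cmod (h s) * norm (x - f s) \<le> 2 * \<eta>"
      proof (cases "s \<in> U")
        case True
        then have "cmod (h s) * norm (x - f s) \<le> 1 * \<eta>"
          using h_le[of s] by (intro mult_mono) (auto simp: U_def)
        then show ?thesis using \<eta>(1) by simp
      next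
        case False
        have "norm (x - f s) \<le> 2"
          using norm_triangle_ineq4[of x "f s"] f_le[of s] f_le[of t0] by (simp add: x_def)
        then have "cmod (h s) * norm (x - f s) \<le> \<eta> * 2"
          using h_off[OF False] \<eta>(1) by (intro mult_mono) auto
        then show ?thesis by simp
      qed
      also have "cmod (1 - h s) * norm (f s) \<le> 2 * 1"
        using norm_triangle_ineq4[of 1 "h s"] h_le[of s] f_le[of s] by (intro mult_mono) auto
      finally show ?thesis using \<eta>(1) by simp
    qed
    then have "norm (y - f) \<le> 4 * \<eta>" by (rule norm_bound)
    with \<eta>(3) show ?thesis by (simp add: dist_norm)
  qed
  ultimately show ?thesis by blast
qed

theorem theorem5p9:
  fixes F :: "('k::t2_space \<Rightarrow>\<^sub>C 'x::{complex_normed_vector, banach}) set"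
    and A :: "('k \<Rightarrow>\<^sub>C complex) set"
    and \<Gamma> \<Gamma>' :: "'k set"
  assumes "compact (UNIV :: 'k set)"
    and "\<exists>x :: 'x. x \<noteq> 0"
    and "uniformly_convex TYPE('x)"
    and "function_space_over_uniform_algebra F"
    and "A = base_algebra F"
    and "elementary_tensors A \<subseteq> F"
    and "\<Gamma> = shilov_boundary A"
    and "\<Gamma>' = {t \<in> \<Gamma>. t islimpt \<Gamma>}"
    and "strong_peak_points A \<inter> \<Gamma>' \<noteq> {}"
  shows "convex_DLD2P F"
proof -
  have A: "uniform_algebra A" and module: "\<And>\<phi> f. \<phi> \<in> A \<Longrightarrow> f \<in> F \<Longrightarrow> \<phi> \<odot> f \<in> F"
    and "closed F" and F: "subspace F"
    using assms(4,5) by (auto simp: function_space_over_uniform_algebra_def intro: scaleC_subspace_imp_subspace)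
  obtain t0 where t0: "t0 \<in> strong_peak_points A" "t0 islimpt shilov_boundary A"
    using assms(7-9) by blast
  have "{g\<in>F. norm g = 1 \<and> norm (apply_bcontfun g t0) = 1} \<subseteq> Delta_points F"
    using Delta_point_if_norm_attained_at_limit_point[OF assms(1) A module t0(2)] by blast
  then have hull: "convex hull {g\<in>F. norm g = 1 \<and> norm (apply_bcontfun g t0) = 1} \<subseteq> convex hull Delta_points F"
    by (rule hull_mono)
  have "{z\<in>F. norm z \<le> 1} \<subseteq> closure (convex hull Delta_points F)"
  proof
    fix f assume "f \<in> {z\<in>F. norm z \<le> 1}"
    then have "f \<in> F" "norm f \<le> 1" by auto
    with hull show "f \<in> closure (convex hull Delta_points F)"
      unfolding closure_approachable
      using approx_norm_attained_at_peak_point[OF assms(1) A F module assms(6,2) t0(1)] by blast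
  qed
  moreover have "closure (convex hull Delta_points F) \<subseteq> {z\<in>F. norm z \<le> 1}"
  proof -
    have eq: "{z\<in>F. norm z \<le> 1} = F \<inter> cball 0 1" by auto
    have "convex {z\<in>F. norm z \<le> 1}"
      unfolding eq by (intro convex_Int subspace_imp_convex F convex_cball)
    moreover have "closed {z\<in>F. norm z \<le> 1}"
      unfolding eq by (intro closed_Int \<open>closed F\<close> closed_cball)
    ultimately show ?thesis
      by (intro closure_minimal hull_minimal) (auto simp: Delta_points_def)
  qed
  ultimately show ?thesis
    unfolding convex_DLD2P_def by (rule antisym)
qed

end
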